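(* Let $\mathbf{P}$ be a non-$\Sigma$ operad with $\mathbf{P}(0)=(0)$. Then $\mathbf{P}=\bigoplus_{n\ge1}\mathbf{P}(n)$, with the elements of $\mathbf{P}(n)$ of degree $n-1$, is a graded (right) pre-Lie algebra with the product $$\forall p\in\mathbf{P}(n),\ q\in\mathbf{P},\quad p\bullet q=\sum_{i=1}^n p\circ_i q.$$ Its $\mathbf{b}_\infty$ brackets are given by $$\forall p\in\mathbf{P}(n),\ p_1,\ldots,p_k\in\mathbf{P},\quad\lfloor p,p_1\cdots p_k\rfloor=\sum_{\substack{1\le i_1,\ldots,i_k\le n,\\ \text{all distinct}}}p\circ_{i_1,\ldots,i_k}(p_1,\ldots,p_k).$$
   Context: Vector spaces are over a field of characteristic zero. A non-$\Sigma$ operad is a family of vector spaces $(\mathbf{P}(n))_{n\ge0}$ with associative compositions $p\circ(p_1,\ldots,p_n)$ and a unit $I\in\mathbf{P}(1)$. For distinct $i_1,\ldots,i_k\in[n]$, $p\circ_{i_1,\ldots,i_k}(p_1,\ldots,p_k)=p\circ(p'_1,\ldots,p'_n)$ with $p'_{i_l}=p_l$ and $p'_j=I$ for the other $j$. A right pre-Lie algebra is a vector space with a bilinear product such that $x\bullet(y\bullet z)-(x\bullet y)\bullet z=x\bullet(z\bullet y)-(x\bullet z)\bullet y$. Its $\mathbf{b}_\infty$ brackets $\lfloor-,-\rfloor:V\otimes S(V)\to V$ are defined inductively by $\lfloor x,1\rfloor=x$, $\lfloor x,y\rfloor=x\bullet y$ and $$\lfloor x,x_1\cdots x_k\rfloor=\lfloor\lfloor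 x,x_1\cdots x_{k-1}\rfloor,x_k\rfloor-\sum_{i=1}^{k-1}\lfloor x,x_1\cdots\lfloor x_i,x_k\rfloor\cdots x_{k-1}\rfloor$$ (these are the Oudom–Guin symmetric braces; the brackets with first argument in $S^k(V)$, $k\ge2$, are zero). *)

theory Defs
  imports Complex_Main "HOL-Library.Poly_Mapping" "HOL-Library.Multiset"
begin

text \<open>
  The vector spaces \<open>P n\<close> are subspaces of one ambient vector space; no relation between
  different \<open>P n\<close> is required, so (up to isomorphism) this is an arbitrary family.
  Hence an element does not determine its arity, and the composition carries the arities of its
  inner arguments: \<open>\<gamma> [k\<^sub>1, \<dots>, k\<^sub>n] p [q\<^sub>1, \<dots>, q\<^sub>n]\<close> is \<open>p \<circ> (q\<^sub>1, \<dots>, q\<^sub>n)\<close> for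
  \<open>p \<in> P n\<close> and \<open>q\<^sub>i \<in> P k\<^sub>i\<close>. The values of \<open>\<gamma>\<close> on other arguments are irrelevant.
\<close>

locale nonsigma_operad = vector_space scale
  for scale :: "'k::field_char_0 \<Rightarrow> 'v::ab_group_add \<Rightarrow> 'v" +
  fixes P :: "nat \<Rightarrow> 'v set"
    and \<gamma> :: "nat list \<Rightarrow> 'v \<Rightarrow> 'v list \<Rightarrow> 'v"
    and I :: 'v
  assumes subspace_P: "subspace (P n)"
    and comp_closed:
      "\<lbrakk>p \<in> P (length ks); list_all2 (\<lambda>k q. q \<in> P k) ks qs\<rbrakk> \<Longrightarrow> \<gamma> ks p qs \<in> P (sum_list ks)"
    and comp_add_outer:
      "\<lbrakk>p \<in> P (length ks); p' \<in> P (length ks); list_all2 (\<lambda>k q. q \<in> P k) ks qs\<rbrakk>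
        \<Longrightarrow> \<gamma> ks (p + p') qs = \<gamma> ks p qs + \<gamma> ks p' qs"
    and comp_scale_outer:
      "\<lbrakk>p \<in> P (length ks); list_all2 (\<lambda>k q. q \<in> P k) ks qs\<rbrakk>
        \<Longrightarrow> \<gamma> ks (scale c p) qs = scale c (\<gamma> ks p qs)"
    and comp_add_inner:
      "\<lbrakk>p \<in> P (length ks); list_all2 (\<lambda>k q. q \<in> P k) ks qs; i < length ks;
        q \<in> P (ks ! i); q' \<in> P (ks ! i)\<rbrakk>
        \<Longrightarrow> \<gamma> ks p (qs[i := q + q']) = \<gamma> ks p (qs[i := q]) + \<gamma> ks p (qs[i := q'])"
    and comp_scale_inner:
      "\<lbrakk>p \<in> P (length ks); list_all2 (\<lambda>k q. q \<in> P k) ks qs; i < length ks; q \<in> P (ks ! i)\<rbrakk>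
        \<Longrightarrow> \<gamma> ks p (qs[i := scale c q]) = scale c (\<gamma> ks p (qs[i := q]))"
    and unit_closed: "I \<in> P 1"
    and unit_left: "p \<in> P n \<Longrightarrow> \<gamma> [n] I [p] = p"
    and unit_right: "p \<in> P n \<Longrightarrow> \<gamma> (replicate n 1) p (replicate n I) = p"
    and comp_assoc:
      "\<lbrakk>p \<in> P (length ks); list_all2 (\<lambda>k q. q \<in> P k) ks qs;
        list_all2 (\<lambda>k l. length l = k) ks ls;
        list_all2 (list_all2 (\<lambda>l r. r \<in> P l)) ls rs\<rbrakk>
        \<Longrightarrow> \<gamma> (concat ls) (\<gamma> ks p qs) (concat rs)
          = \<gamma> (map sum_list ls) p (map (\<lambda>(l, q, r). \<gamma> l q r) (zip ls (zip qs rs)))"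

text \<open>
  The direct sum of the \<open>P n\<close>, \<open>n \<ge> 1\<close>, as finitely supported functions; the inclusion of
  \<open>P n\<close> is \<^const>\<open>Poly_Mapping.single\<close> \<open>n\<close>.
\<close>

definition operad_sum :: "(nat \<Rightarrow> 'v::zero set) \<Rightarrow> (nat \<Rightarrow>\<^sub>0 'v) set" where
  "operad_sum P = {f. Poly_Mapping.lookup f 0 = 0 \<and> (\<forall>n\<ge>1. Poly_Mapping.lookup f n \<in> P n)}"

definition scale_sum :: "('k \<Rightarrow> 'v \<Rightarrow> 'v) \<Rightarrow> 'k \<Rightarrow> (nat \<Rightarrow>\<^sub>0 'v) \<Rightarrow> (nat \<Rightarrow>\<^sub>0 'v::zero)" where
  "scale_sum scale c = Poly_Mapping.map (scale c)"

definition degree_part :: "(nat \<Rightarrow> 'v::zero set) \<Rightarrow> nat \<Rightarrow> (nat \<Rightarrow>\<^sub>0 'v) set" where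
  "degree_part P d = Poly_Mapping.single (Suc d) ` P (Suc d)"

text \<open>
  \<open>p \<circ> (q\<^sub>1, \<dots>, q\<^sub>n)\<close> for \<open>p \<in> P n\<close> and arbitrary (inhomogeneous) elements \<open>q\<^sub>i\<close> of the direct
  sum, by multilinear extension over the homogeneous components of the \<open>q\<^sub>i\<close>.
\<close>

definition full_comp ::
  "(nat list \<Rightarrow> 'v \<Rightarrow> 'v list \<Rightarrow> 'v::comm_monoid_add) \<Rightarrow> 'v \<Rightarrow> (nat \<Rightarrow>\<^sub>0 'v) list \<Rightarrow> (nat \<Rightarrow>\<^sub>0 'v)" where
  "full_comp \<gamma> p qs =
    (\<Sum>ks \<in> listset (map Poly_Mapping.keys qs). Poly_Mapping.single (sum_list ks) (\<gamma> ks p (map2 Poly_Mapping.lookup qs ks)))"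

text \<open>
  \<open>p \<circ>\<^bsub>i\<^sub>1,\<dots>,i\<^sub>k\<^esub> (q\<^sub>1, \<dots>, q\<^sub>k)\<close> for \<open>p \<in> P n\<close>, with positions counted from \<open>1\<close>.
\<close>

definition insert_comp ::
  "(nat list \<Rightarrow> 'v \<Rightarrow> 'v list \<Rightarrow> 'v::comm_monoid_add) \<Rightarrow> 'v \<Rightarrow> nat \<Rightarrow> 'v \<Rightarrow> nat list
    \<Rightarrow> (nat \<Rightarrow>\<^sub>0 'v) list \<Rightarrow> (nat \<Rightarrow>\<^sub>0 'v)" where
  "insert_comp \<gamma> I n p is qs =
    full_comp \<gamma> p
      (map (\<lambda>j. case map_of (zip is qs) j of Some q \<Rightarrow> q | None \<Rightarrow> Poly_Mapping.single 1 I) [1..<Suc n])"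

text \<open>
  The product \<open>p \<bullet> q = (\<Sum>i=1..n. p \<circ>\<^sub>i q)\<close> for \<open>p \<in> P n\<close>, extended linearly in the left factor.
\<close>

definition pre_lie_prod ::
  "(nat list \<Rightarrow> 'v \<Rightarrow> 'v list \<Rightarrow> 'v::comm_monoid_add) \<Rightarrow> 'v
    \<Rightarrow> (nat \<Rightarrow>\<^sub>0 'v) \<Rightarrow> (nat \<Rightarrow>\<^sub>0 'v) \<Rightarrow> (nat \<Rightarrow>\<^sub>0 'v)" where
  "pre_lie_prod \<gamma> I f q = (\<Sum>n \<in> Poly_Mapping.keys f. \<Sum>i=1..n. insert_comp \<gamma> I n (Poly_Mapping.lookup f n) [i] [q])"

locale right_pre_lie_algebra = vector_space scale
  for scale :: "'k::field_char_0 \<Rightarrow> 'a::ab_group_add \<Rightarrow> 'a" +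
  fixes V :: "'a set"
    and pl :: "'a \<Rightarrow> 'a \<Rightarrow> 'a"  (infixl \<open>\<bullet>\<close> 70)
  assumes subspace_V: "subspace V"
    and prod_closed: "\<lbrakk>x \<in> V; y \<in> V\<rbrakk> \<Longrightarrow> x \<bullet> y \<in> V"
    and prod_add_left: "\<lbrakk>x \<in> V; x' \<in> V; y \<in> V\<rbrakk> \<Longrightarrow> (x + x') \<bullet> y = x \<bullet> y + x' \<bullet> y"
    and prod_scale_left: "\<lbrakk>x \<in> V; y \<in> V\<rbrakk> \<Longrightarrow> scale c x \<bullet> y = scale c (x \<bullet> y)"
    and prod_add_right: "\<lbrakk>x \<in> V; y \<in> V; y' \<in> V\<rbrakk> \<Longrightarrow> x \<bullet> (y + y') = x \<bullet> y + x \<bullet> y'"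
    and prod_scale_right: "\<lbrakk>x \<in> V; y \<in> V\<rbrakk> \<Longrightarrow> x \<bullet> scale c y = scale c (x \<bullet> y)"
    and pre_lie: "\<lbrakk>x \<in> V; y \<in> V; z \<in> V\<rbrakk>
      \<Longrightarrow> x \<bullet> (y \<bullet> z) - (x \<bullet> y) \<bullet> z = x \<bullet> (z \<bullet> y) - (x \<bullet> z) \<bullet> y"

text \<open>The grading involves no Koszul signs.\<close>

locale graded_right_pre_lie_algebra = right_pre_lie_algebra scale V pl
  for scale :: "'k::field_char_0 \<Rightarrow> 'a::ab_group_add \<Rightarrow> 'a"
    and V :: "'a set"
    and pl :: "'a \<Rightarrow> 'a \<Rightarrow> 'a"  (infixl \<open>\<bullet>\<close> 70) +
  fixes D :: "nat \<Rightarrow> 'a set"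
  assumes subspace_D: "subspace (D d)"
    and D_subset: "D d \<subseteq> V"
    and decomposition: "x \<in> V
      \<Longrightarrow> \<exists>!f. (\<forall>d. f d \<in> D d) \<and> finite {d. f d \<noteq> 0} \<and> x = (\<Sum>d | f d \<noteq> 0. f d)"
    and prod_degree: "\<lbrakk>x \<in> D d; y \<in> D e\<rbrakk> \<Longrightarrow> x \<bullet> y \<in> D (d + e)"

text \<open>
  The brackets of a pre-Lie algebra on monomials: \<open>brace pl x [x\<^sub>1, \<dots>, x\<^sub>k]\<close> is
  \<open>\<lfloor>x, x\<^sub>1 \<dots> x\<^sub>k\<rfloor>\<close>. Brackets with second argument of length one are written out as products in
  the recursion; the second equation therefore includes \<open>\<lfloor>x, y\<rfloor> = x \<bullet> y\<close>.
\<close>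

function brace :: "('a \<Rightarrow> 'a \<Rightarrow> 'a) \<Rightarrow> 'a \<Rightarrow> 'a list \<Rightarrow> 'a::ab_group_add" where
  "brace pl x [] = x"
| "brace pl x (xs @ [y]) =
    pl (brace pl x xs) y - (\<Sum>i<length xs. brace pl x (xs[i := pl (xs ! i) y]))"
  by (auto, metis rev_exhaust)
termination
  by (relation "measure (\<lambda>(_, _, xs). length xs)") auto

text \<open>
  A family of maps given on lists defines a linear map \<open>V \<otimes> S(V) \<rightarrow> V\<close> iff it is multilinear and
  invariant under permutation of the list.
\<close>

definition defines_map_on_symmetric_algebra ::
  "('k \<Rightarrow> 'a \<Rightarrow> 'a) \<Rightarrow> 'a set \<Rightarrow> ('a \<Rightarrow> 'a list \<Rightarrow> 'a::ab_group_add) \<Rightarrow> bool" where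
  "defines_map_on_symmetric_algebra scale V B \<longleftrightarrow>
    (\<forall>x\<in>V. \<forall>ys\<in>lists V. B x ys \<in> V) \<and>
    (\<forall>x\<in>V. \<forall>x'\<in>V. \<forall>ys\<in>lists V. B (x + x') ys = B x ys + B x' ys) \<and>
    (\<forall>c. \<forall>x\<in>V. \<forall>ys\<in>lists V. B (scale c x) ys = scale c (B x ys)) \<and>
    (\<forall>x\<in>V. \<forall>ys\<in>lists V. \<forall>i<length ys. \<forall>y\<in>V. \<forall>y'\<in>V.
      B x (ys[i := y + y']) = B x (ys[i := y]) + B x (ys[i := y'])) \<and>
    (\<forall>c. \<forall>x\<in>V. \<forall>ys\<in>lists V. \<forall>i<length ys. \<forall>y\<in>V.
      B x (ys[i := scale c y]) = scale c (B x (ys[i := y]))) \<and>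
    (\<forall>x\<in>V. \<forall>ys\<in>lists V. \<forall>zs. mset ys = mset zs \<longrightarrow> B x ys = B x zs)"

end

theory Submission
  imports Defs "HOL-Combinatorics.Permutations"
begin

text \<open>
  By associativity, grafting \<open>r\<close> at a leaf of \<open>p \<circ> (q\<^sub>1, \<dots>, q\<^sub>n)\<close> is grafting it at a leaf of one of
  the \<open>q\<^sub>j\<close>, so \<open>(p \<circ> (q\<^sub>1, \<dots>, q\<^sub>n)) \<bullet> r = (\<Sum>j. p \<circ> (q\<^sub>1, \<dots>, q\<^sub>j \<bullet> r, \<dots>, q\<^sub>n))\<close>.
  Let \<open>B(p; q\<^sub>1 \<dots> q\<^sub>k)\<close> be the sum of all insertions of the \<open>q\<^sub>i\<close> at distinct positions of \<open>p\<close>.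
  Since \<open>I \<bullet> r = r\<close>, in \<open>B(p; q\<^sub>1 \<dots> q\<^sub>k) \<bullet> r\<close> the positions still filled with \<open>I\<close> contribute
  \<open>B(p; q\<^sub>1 \<dots> q\<^sub>k r)\<close>, and the other ones contribute the sum of the
  \<open>B(p; q\<^sub>1 \<dots> (q\<^sub>i \<bullet> r) \<dots> q\<^sub>k)\<close>. This is the recursion of the brackets, so the brackets are \<open>B\<close>,
  which is visibly symmetric; its symmetry for \<open>k = 2\<close> is the pre-Lie identity.
\<close>

section \<open>Sums and updates of concatenated lists\<close>

lemma sum_lessThan_add:
  fixes h :: "nat \<Rightarrow> 'a::comm_monoid_add"
  shows "(\<Sum>i<a + b. h i) = (\<Sum>i<a. h i) + (\<Sum>i<b. h (a + i))"
  by (induction b) (simp_all add: add.assoc)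

text \<open>For \<open>ks\<close> the arities of the inner arguments, this groups the leaves of a
  composite by the argument that carries them: the block of argument \<open>j\<close> starts after
  the \<open>sum_list (take j ks)\<close> leaves of the earlier arguments.\<close>

lemma sum_lessThan_sum_list:
  fixes h :: "nat \<Rightarrow> 'a::comm_monoid_add"
  shows "(\<Sum>i<sum_list ks. h i) = (\<Sum>j<length ks. \<Sum>t<ks ! j. h (sum_list (take j ks) + t))"
proof (induction ks arbitrary: h)
  case (Cons k ks)
  show ?case
    by (simp add: sum_lessThan_add Cons.IH sum.lessThan_Suc_shift add.assoc del: sum.lessThan_Suc)
qed simp

text \<open>Associativity of an operad concatenates the innermost arguments. This translates a
  change inside one block into a change of the flat list, with the same offset as in
  \<open>sum_lessThan_sum_list\<close>.\<close>

lemma concat_list_update: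
  assumes "j < length xss" "t < length (xss ! j)"
  shows "concat (xss[j := (xss ! j)[t := v]])
    = (concat xss)[sum_list (map length (take j xss)) + t := v]"
  using assms
proof (induction xss arbitrary: j)
  case (Cons xs xss)
  then show ?case
    by (cases j) (auto simp: list_update_append add.assoc)
qed simp

lemma mem_listset_iff: "ks \<in> listset As \<longleftrightarrow> list_all2 (\<in>) ks As"
  by (induction As arbitrary: ks) (auto simp: set_Cons_def list_all2_Cons2)

section \<open>Placements of arguments at distinct positions\<close>

definition placements :: "nat \<Rightarrow> nat \<Rightarrow> nat list set" where
  "placements n k = {is. length is = k \<and> set is \<subseteq> {1..n} \<and> distinct is}"

lemma finite_placements: "finite (placements n k)"
  by (rule finite_subset[OF _ finite_lists_length_eq[of "{1..n}" k]]) (auto simp: placements_def)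

lemma placements_0: "placements n 0 = {[]}"
  by (auto simp: placements_def)

text \<open>Dropping the last entry leaves a placement of the first \<open>k\<close> arguments, and
  the dropped entry is any position still free. In \<open>pl_symmetric_brace\<close> these free
  positions are where a new argument lands.\<close>

lemma sum_placements_Suc:
  "(\<Sum>is\<in>placements n (Suc k). h is)
    = (\<Sum>is\<in>placements n k. \<Sum>j\<in>{1..n} - set is. h (is @ [j]))"
proof -
  have "(\<Sum>is\<in>placements n (Suc k). h is)
      = (\<Sum>(is, j)\<in>(SIGMA is:placements n k. {1..n} - set is). h (is @ [j]))"
    by (rule sum.reindex_bij_witness[of _ "\<lambda>(is, j). is @ [j]" "\<lambda>is. (butlast is, last is)"])
      (auto simp: placements_def length_Suc_conv_rev)
  then show ?thesis
    by (simp add: sum.Sigma finite_placements)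
qed

text \<open>Positions are counted from \<open>1\<close>, whereas list indices start at \<open>0\<close>.\<close>

definition plug :: "'a \<Rightarrow> nat \<Rightarrow> nat list \<Rightarrow> 'a list \<Rightarrow> 'a list" where
  "plug u n is qs =
    map (\<lambda>j. case map_of (zip is qs) j of Some q \<Rightarrow> q | None \<Rightarrow> u) [1..<Suc n]"

lemma length_plug [simp]: "length (plug u n is qs) = n"
  by (simp add: plug_def)

lemma nth_plug:
  "j < n \<Longrightarrow> plug u n is qs ! j = (case map_of (zip is qs) (Suc j) of Some q \<Rightarrow> q | None \<Rightarrow> u)"
  by (simp add: plug_def nth_append del: upt_Suc)

lemma plug_Nil: "plug u n [] [] = replicate n u"
  by (rule nth_equalityI) (simp_all add: nth_plug)

lemma set_plug_subset: "u \<in> A \<Longrightarrow> set qs \<subseteq> A \<Longrightarrow> set (plug u n is qs) \<subseteq> A"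
proof
  fix x assume "x \<in> set (plug u n is qs)" and sub: "u \<in> A" "set qs \<subseteq> A"
  then obtain j where "x = (case map_of (zip is qs) j of Some q \<Rightarrow> q | None \<Rightarrow> u)"
    by (auto simp: plug_def)
  then show "x \<in> A"
    using sub by (cases "map_of (zip is qs) j") (auto dest: map_of_SomeD set_zip_rightD)
qed

lemma nth_plug_notin:
  assumes "length is = length qs" "l < n" "Suc l \<notin> set is"
  shows "plug u n is qs ! l = u"
proof -
  have "map_of (zip is qs) (Suc l) = None"
    using assms by simp
  then show ?thesis
    using assms(2) by (simp only: nth_plug option.case)
qed

lemma nth_plug_in:
  assumes "length is = length qs" "distinct is" "i < length is" "is ! i = Suc l" "l < n"
  shows "plug u n is qs ! l = qs ! i"
proof -
  have "map_of (zip is qs) (Suc l) = Some (qs ! i)"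
    using map_of_zip_nth[of "is" qs i] assms by metis
  then show ?thesis
    using assms(5) by (simp only: nth_plug option.case)
qed

text \<open>Since \<open>Suc j\<close> is not taken yet, the new pair at the end of the association
  list is not shadowed by an earlier one, although \<open>map_of\<close> takes the first
  match.\<close>

lemma plug_snoc:
  assumes "length is = length qs" "distinct is" "Suc j \<notin> set is"
  shows "plug u n (is @ [Suc j]) (qs @ [q]) = (plug u n is qs)[j := q]"
proof (rule nth_equalityI)
  fix l assume "l < length (plug u n (is @ [Suc j]) (qs @ [q]))"
  then have l: "l < n"
    by simp
  consider "l = j" | "l \<noteq> j" "Suc l \<notin> set is"
    | i where "l \<noteq> j" "i < length is" "is ! i = Suc l"
    by (metis in_set_conv_nth)
  then show "plug u n (is @ [Suc j]) (qs @ [q]) ! l = (plug u n is qs)[j := q] ! l"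
  proof cases
    case 1
    then show ?thesis
      using assms l nth_plug_in[of "is @ [Suc j]" "qs @ [q]" "length is" l n u] by (simp add: nth_append)
  next
    case 2
    then show ?thesis
      using assms l nth_plug_notin[of "is @ [Suc j]" "qs @ [q]" l n u]
        nth_plug_notin[of "is" qs l n u] by simp
  next
    case 3
    then show ?thesis
      using assms l nth_plug_in[of "is @ [Suc j]" "qs @ [q]" i l n u]
        nth_plug_in[of "is" qs i l n u] by (simp add: nth_append)
  qed
qed simp

lemma plug_list_update:
  assumes "length is = length qs" "distinct is" "i < length is" "is ! i = Suc j"
  shows "plug u n is (qs[i := q]) = (plug u n is qs)[j := q]"
proof (rule nth_equalityI)
  fix l assume "l < length (plug u n is (qs[i := q]))"
  then have l: "l < n"
    by simp
  show "plug u n is (qs[i := q]) ! l = (plug u n is qs)[j := q] ! l"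
  proof (cases "Suc l \<in> set is")
    case True
    then obtain m where m: "m < length is" "is ! m = Suc l"
      by (meson in_set_conv_nth)
    moreover have "j = l \<longleftrightarrow> i = m"
      using m assms nth_eq_iff_index_eq[of "is" i m] by auto
    ultimately show ?thesis
      using l assms nth_plug_in[of "is" qs m l n u] nth_plug_in[of "is" "qs[i := q]" m l n u]
      by (auto simp: nth_list_update)
  next
    case False
    moreover have "j \<noteq> l"
      using False assms(3,4) nth_mem[of i "is"] by auto
    ultimately show ?thesis
      using l assms nth_plug_notin[of "is" qs l n u] nth_plug_notin[of "is" "qs[i := q]" l n u]
      by simp
  qed
qed simp

text \<open>As the positions are distinct, \<open>map_of\<close> depends only on the set of pairs of
  a position and its argument, and a simultaneous permutation keeps that set.\<close>

lemma plug_permute_list: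
  assumes "p permutes {..<length qs}" "length is = length qs" "distinct is"
  shows "plug u n (permute_list p is) (permute_list p qs) = plug u n is qs"
proof -
  have "zip (permute_list p is) (permute_list p qs) = permute_list p (zip is qs)"
    using assms by (intro permute_list_zip[symmetric]) simp_all
  then have "set (zip (permute_list p is) (permute_list p qs)) = set (zip is qs)"
    using assms by simp
  moreover have "distinct (permute_list p is)"
    using assms by simp
  ultimately have "map_of (zip (permute_list p is) (permute_list p qs)) = map_of (zip is qs)"
    using assms by (subst map_of_inject_set) simp_all
  then show ?thesis
    by (simp add: plug_def)
qed

text \<open>Source of the symmetry of the brackets. When the arguments are permuted, permuting the
  positions in the same way keeps the filled list, and it is a bijection of the placements.\<close>

lemma sum_placements_mset_eq:
  assumes "mset qs = mset rs"
  shows "(\<Sum>is\<in>placements n (length qs). g (plug u n is qs))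
    = (\<Sum>is\<in>placements n (length rs). g (plug u n is rs))"
proof -
  obtain p where p: "p permutes {..<length rs}" "permute_list p rs = qs"
    using mset_eq_permutation[OF assms] .
  have len: "length qs = length rs"
    using assms by (rule mset_eq_length)
  have ip: "inv p permutes {..<length rs}"
    using p(1) by (rule permutes_inv)
  have [simp]: "permute_list p (permute_list (inv p) is) = is"
    "permute_list (inv p) (permute_list p is) = is" if "length is = length rs" for "is" :: "nat list"
    using that p(1) ip permute_list_compose[of p "is" "inv p"] permute_list_compose[of "inv p" "is" p]
    by (simp_all add: permutes_inv_o)
  have "plug u n (permute_list (inv p) is) rs = plug u n is qs" if "length is = length rs" "distinct is" for "is"
    using plug_permute_list[of p rs "permute_list (inv p) is" u n] p ip that by simp
  then show ?thesis
    by (intro sum.reindex_bij_witness[of _ "permute_list p" "permute_list (inv p)"])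
      (use p ip in \<open>simp_all add: placements_def len\<close>)
qed

section \<open>Components of finitely supported functions and additivity in each slot\<close>

lemma poly_mapping_sum_single:
  assumes "finite K" "Poly_Mapping.keys f \<subseteq> K"
  shows "(\<Sum>n\<in>K. Poly_Mapping.single n (Poly_Mapping.lookup f n)) = f"
proof (rule poly_mapping_eqI)
  fix k
  have "Poly_Mapping.lookup f k = 0" if "k \<notin> K"
    using assms that by (auto simp: in_keys_iff)
  then show "Poly_Mapping.lookup (\<Sum>n\<in>K. Poly_Mapping.single n (Poly_Mapping.lookup f n)) k = Poly_Mapping.lookup f k"
    using assms by (simp add: lookup_sum lookup_single when_def)
qed

lemma concat_map_replicate: "concat (map (\<lambda>k. replicate k x) ks) = replicate (sum_list ks) x"
  by (induction ks) (simp_all add: replicate_add)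

lemma sum_list_concat: "sum_list (concat xss) = sum_list (map sum_list xss)"
  by (induction xss) simp_all

text \<open>Additivity suffices to determine a map on lists from its values on homogeneous lists,
  because every element is a sum of homogeneous ones. The restriction to \<open>A\<close> is there
  because the operad axioms control \<open>\<gamma>\<close> on the spaces \<open>P k\<close>
  only.\<close>

definition additive_slots :: "'a::plus set \<Rightarrow> nat \<Rightarrow> ('a list \<Rightarrow> 'b::plus) \<Rightarrow> bool" where
  "additive_slots A n F \<longleftrightarrow>
    (\<forall>qs i q q'. length qs = n \<and> set qs \<subseteq> A \<and> i < n \<and> q \<in> A \<and> q' \<in> A
      \<longrightarrow> F (qs[i := q + q']) = F (qs[i := q]) + F (qs[i := q']))"

lemma additive_slotsD:
  "\<lbrakk>additive_slots A n F; length qs = n; set qs \<subseteq> A; i < n; q \<in> A; q' \<in> A\<rbrakk>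
    \<Longrightarrow> F (qs[i := q + q']) = F (qs[i := q]) + F (qs[i := q'])"
  by (simp add: additive_slots_def)

lemma (in vector_space) lookup_scale_sum:
  "Poly_Mapping.lookup (scale_sum scale c f) n = scale c (Poly_Mapping.lookup f n)"
  by (simp add: scale_sum_def Poly_Mapping.map.rep_eq when_def)

lemma (in vector_space) vector_space_scale_sum: "vector_space (scale_sum scale)"
  by unfold_locales
    (auto intro!: poly_mapping_eqI simp: lookup_scale_sum lookup_add scale_right_distrib scale_left_distrib)

section \<open>The direct sum of the spaces of the operad\<close>

locale reduced_nonsigma_operad = nonsigma_operad scale P \<gamma> I
  for scale :: "'k::field_char_0 \<Rightarrow> 'v::ab_group_add \<Rightarrow> 'v"
    and P :: "nat \<Rightarrow> 'v set"
    and \<gamma> :: "nat list \<Rightarrow> 'v \<Rightarrow> 'v list \<Rightarrow> 'v"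
    and I :: 'v +
  assumes P_0: "P 0 = {0}"
begin

declare One_nat_def [simp del]

abbreviation "V \<equiv> operad_sum P"
abbreviation "u \<equiv> Poly_Mapping.single (1::nat) I"
abbreviation "scl \<equiv> scale_sum scale"
abbreviation "\<Gamma> \<equiv> full_comp \<gamma>"
abbreviation "pl \<equiv> pre_lie_prod \<gamma> I"

sublocale sum: vector_space scl
  by (rule vector_space_scale_sum)

lemma P_zero: "0 \<in> P n"
  and P_add: "\<lbrakk>x \<in> P n; y \<in> P n\<rbrakk> \<Longrightarrow> x + y \<in> P n"
  and P_scale: "x \<in> P n \<Longrightarrow> scale c x \<in> P n"
  using subspace_P by (auto simp: subspace_def)

text \<open>\<open>P 0 = {0}\<close> turns the separate condition at 0 into an instance of the
  general one, so that membership can be checked in all arities alike.\<close>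

lemma operad_sum_iff: "f \<in> V \<longleftrightarrow> (\<forall>n. Poly_Mapping.lookup f n \<in> P n)"
proof -
  have "Poly_Mapping.lookup f n \<in> P n" if "f \<in> V" for n
    using that P_0 by (cases n) (auto simp: operad_sum_def)
  then show ?thesis
    using P_0 by (auto simp: operad_sum_def)
qed

lemma lookup_in_P: "f \<in> V \<Longrightarrow> Poly_Mapping.lookup f n \<in> P n"
  by (simp add: operad_sum_iff)

lemma subspace_V: "sum.subspace V"
  by (auto simp: sum.subspace_def operad_sum_iff lookup_add lookup_scale_sum P_zero P_add P_scale)

lemma V_sum: "(\<And>x. x \<in> X \<Longrightarrow> g x \<in> V) \<Longrightarrow> (\<Sum>x\<in>X. g x) \<in> V"
  by (rule sum.subspace_sum[OF subspace_V])

lemma V_add: "\<lbrakk>x \<in> V; y \<in> V\<rbrakk> \<Longrightarrow> x + y \<in> V"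
  by (rule sum.subspace_add[OF subspace_V])

lemma V_scale: "x \<in> V \<Longrightarrow> scl c x \<in> V"
  by (rule sum.subspace_scale[OF subspace_V])

lemma V_single: "x \<in> P n \<Longrightarrow> Poly_Mapping.single n x \<in> V"
  by (auto simp: operad_sum_iff lookup_single when_def P_zero)

lemma V_unit: "u \<in> V"
  by (rule V_single[OF unit_closed])

lemma V_induct [consumes 1, case_names single add]:
  assumes "f \<in> V"
    and single: "\<And>k x. x \<in> P k \<Longrightarrow> Q (Poly_Mapping.single k x)"
    and add: "\<And>f g. \<lbrakk>f \<in> V; g \<in> V; Q f; Q g\<rbrakk> \<Longrightarrow> Q (f + g)"
  shows "Q f"
proof -
  \<comment> \<open>Membership in \<open>V\<close> is carried along since the \<open>add\<close>
    case requires it of both summands.\<close>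
  have *: "(\<Sum>n\<in>K. Poly_Mapping.single n (Poly_Mapping.lookup f n)) \<in> V
      \<and> Q (\<Sum>n\<in>K. Poly_Mapping.single n (Poly_Mapping.lookup f n))" if "finite K" for K
    using that
  proof (induction K rule: finite_induct)
    case empty
    \<comment> \<open>The empty sum is \<open>Poly_Mapping.single 0 0\<close>, so the homogeneous
      case covers it.\<close>
    have "Q 0" "0 \<in> V"
      using single[of 0 0] V_single[of 0 0] P_zero by simp_all
    then show ?case
      by simp
  next
    case (insert n K)
    have "Poly_Mapping.lookup f n \<in> P n"
      using assms(1) by (simp add: operad_sum_iff)
    then show ?case
      using insert by (simp add: add single V_add V_single)
  qed
  show ?thesis
    using *[OF finite_keys] poly_mapping_sum_single[OF finite_keys order.refl, of f] by metis
qed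

section \<open>Reduction to homogeneous arguments\<close>

definition homogeneous :: "(nat \<Rightarrow>\<^sub>0 'v) set" where
  "homogeneous = (\<Union>k. Poly_Mapping.single k ` P k)"

text \<open>Reduces identities between compositions to homogeneous arguments, for which the axiom
  \<open>comp_assoc\<close> is available.\<close>

lemma additive_slots_eqI:
  assumes F: "additive_slots V n F" and G: "additive_slots V n G"
    and eq: "\<And>qs. \<lbrakk>length qs = n; set qs \<subseteq> homogeneous\<rbrakk> \<Longrightarrow> F qs = G qs"
    and "length qs = n" "set qs \<subseteq> V"
  shows "F qs = G qs"
proof -
  \<comment> \<open>Induction on \<open>m\<close>, where only the first \<open>m\<close> slots may
    be inhomogeneous. In the step, slot \<open>m\<close> is built up from homogeneous elements by
    additivity of \<open>F\<close> and \<open>G\<close>; the case \<open>m = n\<close> is the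
    claim.\<close>
  have "F qs = G qs"
    if "length qs = n" "set qs \<subseteq> V" "\<forall>i<n. m \<le> i \<longrightarrow> qs ! i \<in> homogeneous" for m qs
    using that
  proof (induction m arbitrary: qs)
    case 0
    then show ?case
      by (intro eq) (auto simp: in_set_conv_nth)
  next
    case (Suc m)
    show ?case
    proof (cases "m < n")
      case True
      have "F (qs[m := f]) = G (qs[m := f])" if "f \<in> V" for f
        using that
      proof (induction f rule: V_induct)
        case (single k x)
        then have "set (qs[m := Poly_Mapping.single k x]) \<subseteq> V"
          by (intro set_update_subsetI) (use Suc V_single in auto)
        moreover have "Poly_Mapping.single k x \<in> homogeneous"
          using single by (auto simp: homogeneous_def)
        ultimately show ?case
          using Suc.prems by (intro Suc.IH) (auto simp: nth_list_update)
      next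
        case (add f g)
        then show ?case
          using additive_slotsD[OF F Suc.prems(1,2) True, of f g]
            additive_slotsD[OF G Suc.prems(1,2) True, of f g] by simp
      qed
      moreover have "qs ! m \<in> V"
        using Suc.prems True by (metis nth_mem subsetD)
      ultimately show ?thesis
        by (metis list_update_id)
    next
      case False
      then show ?thesis
        using Suc.prems by (intro Suc.IH) auto
    qed
  qed
  from this[of qs n] show ?thesis
    using assms(4,5) by simp
qed

lemma additive_slots_sum:
  fixes F :: "(nat \<Rightarrow>\<^sub>0 'v) list \<Rightarrow> 'c::ab_group_add"
  assumes F: "additive_slots V n F" "length qs = n" "set qs \<subseteq> V" "i < n"
    and "finite X" "\<And>x. x \<in> X \<Longrightarrow> g x \<in> V"
  shows "F (qs[i := \<Sum>x\<in>X. g x]) = (\<Sum>x\<in>X. F (qs[i := g x]))"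
  using assms(5,6)
proof (induction X rule: finite_induct)
  case empty
  have "0 \<in> V"
    using V_sum[of "{}"] by simp
  then show ?case
    using additive_slotsD[OF F, of 0 0] by simp
next
  case (insert x X)
  then show ?case
    using additive_slotsD[OF F, of "g x" "\<Sum>x\<in>X. g x"] by (simp add: V_sum)
qed

section \<open>Multilinear extension of the composition\<close>

lemma comp_zero_inner:
  assumes "p \<in> P (length ks)" "list_all2 (\<lambda>k q. q \<in> P k) ks qs" "i < length ks" "qs ! i = 0"
  shows "\<gamma> ks p qs = 0"
  using comp_scale_inner[OF assms(1-3), of 0 0] P_zero assms(4) by (metis list_update_id scale_zero_left)

lemma components_in:
  "\<lbrakk>set qs \<subseteq> V; length ks = length qs\<rbrakk>
    \<Longrightarrow> list_all2 (\<lambda>k q. q \<in> P k) ks (map2 Poly_Mapping.lookup qs ks)"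
  by (auto simp: list_all2_conv_all_nth operad_sum_iff dest: nth_mem)

text \<open>The index set in the definition of \<open>full_comp\<close> varies with the supports of
  the arguments. Enlarging it to the lists over a common \<open>K\<close> only adds terms with a
  zero inner argument, which vanish. Compositions with different arguments thus become sums over one
  index set.\<close>

lemma full_comp_eq_sum:
  assumes "p \<in> P (length qs)" "set qs \<subseteq> V" "finite K" "\<And>q. q \<in> set qs \<Longrightarrow> Poly_Mapping.keys q \<subseteq> K"
  shows "\<Gamma> p qs = (\<Sum>ks | set ks \<subseteq> K \<and> length ks = length qs.
    Poly_Mapping.single (sum_list ks) (\<gamma> ks p (map2 Poly_Mapping.lookup qs ks)))"
  unfolding full_comp_def
proof (rule sum.mono_neutral_left)
  show "finite {ks. set ks \<subseteq> K \<and> length ks = length qs}"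
    using assms(3) by (rule finite_lists_length_eq)
  show "listset (map Poly_Mapping.keys qs) \<subseteq> {ks. set ks \<subseteq> K \<and> length ks = length qs}"
    using assms(4) by (fastforce simp: mem_listset_iff list_all2_conv_all_nth in_set_conv_nth)
  show "\<forall>ks\<in>{ks. set ks \<subseteq> K \<and> length ks = length qs} - listset (map Poly_Mapping.keys qs).
    Poly_Mapping.single (sum_list ks) (\<gamma> ks p (map2 Poly_Mapping.lookup qs ks)) = 0"
  proof
    fix ks assume "ks \<in> {ks. set ks \<subseteq> K \<and> length ks = length qs} - listset (map Poly_Mapping.keys qs)"
    then obtain i where len: "length ks = length qs" and i: "i < length ks" "ks ! i \<notin> Poly_Mapping.keys (qs ! i)"
      by (auto simp: mem_listset_iff list_all2_conv_all_nth)
    then have "\<gamma> ks p (map2 Poly_Mapping.lookup qs ks) = 0"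
      using assms by (intro comp_zero_inner[where i=i] components_in) (simp_all add: in_keys_iff)
    then show "Poly_Mapping.single (sum_list ks) (\<gamma> ks p (map2 Poly_Mapping.lookup qs ks)) = 0"
      by simp
  qed
qed

lemma full_comp_closed:
  assumes "p \<in> P (length qs)" "set qs \<subseteq> V"
  shows "\<Gamma> p qs \<in> V"
  unfolding full_comp_def
proof (rule V_sum)
  fix ks assume "ks \<in> listset (map Poly_Mapping.keys qs)"
  then have "length ks = length qs"
    by (auto simp: mem_listset_iff dest: list_all2_lengthD)
  then show "Poly_Mapping.single (sum_list ks) (\<gamma> ks p (map2 Poly_Mapping.lookup qs ks)) \<in> V"
    using assms by (intro V_single comp_closed components_in) simp_all
qed

lemma full_comp_add_outer:
  assumes "p \<in> P (length qs)" "p' \<in> P (length qs)" "set qs \<subseteq> V"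
  shows "\<Gamma> (p + p') qs = \<Gamma> p qs + \<Gamma> p' qs"
  unfolding full_comp_def sum.distrib[symmetric]
  by (rule sum.cong)
    (use assms in \<open>auto simp: mem_listset_iff single_add[symmetric] dest!: list_all2_lengthD
      intro!: arg_cong[of _ _ "Poly_Mapping.single _"] comp_add_outer components_in\<close>)

lemma scl_single: "scl c (Poly_Mapping.single n x) = Poly_Mapping.single n (scale c x)"
  by (rule poly_mapping_eqI) (simp add: lookup_scale_sum lookup_single when_def)

lemma full_comp_scale_outer:
  assumes "p \<in> P (length qs)" "set qs \<subseteq> V"
  shows "\<Gamma> (scale c p) qs = scl c (\<Gamma> p qs)"
  unfolding full_comp_def sum.scale_sum_right scl_single
  by (rule sum.cong)
    (use assms in \<open>auto simp: mem_listset_iff dest!: list_all2_lengthD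
      intro!: arg_cong[of _ _ "Poly_Mapping.single _"] comp_scale_outer components_in\<close>)

lemma components_list_update:
  assumes "length ks = length qs"
  shows "map2 Poly_Mapping.lookup (qs[i := q]) ks
    = (map2 Poly_Mapping.lookup qs ks)[i := Poly_Mapping.lookup q (ks ! i)]"
proof (rule nth_equalityI)
  fix l assume "l < length (map2 Poly_Mapping.lookup (qs[i := q]) ks)"
  then show "map2 Poly_Mapping.lookup (qs[i := q]) ks ! l
    = (map2 Poly_Mapping.lookup qs ks)[i := Poly_Mapping.lookup q (ks ! i)] ! l"
    using assms by (cases "l = i") simp_all
qed simp

lemma full_comp_list_update:
  assumes "p \<in> P n" "length qs = n" "set qs \<subseteq> V" "f \<in> V" "finite K"
    and "\<And>g. g \<in> insert f (set qs) \<Longrightarrow> Poly_Mapping.keys g \<subseteq> K"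
  shows "\<Gamma> p (qs[i := f]) = (\<Sum>ks | set ks \<subseteq> K \<and> length ks = n.
    Poly_Mapping.single (sum_list ks)
      (\<gamma> ks p ((map2 Poly_Mapping.lookup qs ks)[i := Poly_Mapping.lookup f (ks ! i)])))"
proof -
  have "set (qs[i := f]) \<subseteq> V"
    using assms(3,4) by (rule set_update_subsetI)
  moreover have "Poly_Mapping.keys g \<subseteq> K" if "g \<in> set (qs[i := f])" for g
    using set_update_subset_insert[of qs i f] assms(6) that by blast
  ultimately show ?thesis
    using assms by (subst full_comp_eq_sum[where K=K]) (auto simp: components_list_update intro!: sum.cong)
qed

lemma additive_slots_full_comp:
  assumes "p \<in> P n"
  shows "additive_slots V n (\<Gamma> p)"
  unfolding additive_slots_def
proof (intro allI impI, elim conjE)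
  fix qs i q q'
  assume qs: "length qs = n" "set qs \<subseteq> V" "i < n" "q \<in> V" "q' \<in> V"
  \<comment> \<open>It contains the supports of \<open>q\<close> and \<open>q'\<close>, hence that
    of \<open>q + q'\<close>, so all three compositions are sums over the same lists of
    arities.\<close>
  let ?K = "(\<Union>f\<in>insert q (insert q' (set qs)). Poly_Mapping.keys f)"
  have comp_eq: "\<Gamma> p (qs[i := f]) = (\<Sum>ks | set ks \<subseteq> ?K \<and> length ks = n.
      Poly_Mapping.single (sum_list ks)
        (\<gamma> ks p ((map2 Poly_Mapping.lookup qs ks)[i := Poly_Mapping.lookup f (ks ! i)])))"
    if f: "f \<in> V" "Poly_Mapping.keys f \<subseteq> ?K" for f
    by (rule full_comp_list_update) (use assms qs f in auto)
  have *: "\<gamma> ks p ((map2 Poly_Mapping.lookup qs ks)[i := Poly_Mapping.lookup (q + q') (ks ! i)])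
      = \<gamma> ks p ((map2 Poly_Mapping.lookup qs ks)[i := Poly_Mapping.lookup q (ks ! i)])
      + \<gamma> ks p ((map2 Poly_Mapping.lookup qs ks)[i := Poly_Mapping.lookup q' (ks ! i)])"
    if "length ks = n" for ks
    unfolding lookup_add
    by (rule comp_add_inner) (use qs assms that in \<open>auto intro!: components_in simp: operad_sum_iff\<close>)
  have "Poly_Mapping.keys (q + q') \<subseteq> ?K"
    using keys_add[of q q'] by blast
  then have "\<Gamma> p (qs[i := q + q']) = (\<Sum>ks | set ks \<subseteq> ?K \<and> length ks = n.
      Poly_Mapping.single (sum_list ks)
        (\<gamma> ks p ((map2 Poly_Mapping.lookup qs ks)[i := Poly_Mapping.lookup (q + q') (ks ! i)])))"
    using qs by (intro comp_eq V_add)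
  also have "\<dots> = (\<Sum>ks | set ks \<subseteq> ?K \<and> length ks = n.
      Poly_Mapping.single (sum_list ks)
        (\<gamma> ks p ((map2 Poly_Mapping.lookup qs ks)[i := Poly_Mapping.lookup q (ks ! i)]))
      + Poly_Mapping.single (sum_list ks)
        (\<gamma> ks p ((map2 Poly_Mapping.lookup qs ks)[i := Poly_Mapping.lookup q' (ks ! i)])))"
    by (rule sum.cong) (auto simp: * single_add)
  also have "\<dots> = \<Gamma> p (qs[i := q]) + \<Gamma> p (qs[i := q'])"
    by (subst (1 2) comp_eq) (use qs in \<open>auto simp: sum.distrib\<close>)
  finally show "\<Gamma> p (qs[i := q + q']) = \<Gamma> p (qs[i := q]) + \<Gamma> p (qs[i := q'])" .
qed

lemma full_comp_scale_inner:
  assumes "p \<in> P (length qs)" "set qs \<subseteq> V" "i < length qs" "q \<in> V"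
  shows "\<Gamma> p (qs[i := scl c q]) = scl c (\<Gamma> p (qs[i := q]))"
proof -
  let ?K = "(\<Union>f\<in>insert q (set qs). Poly_Mapping.keys f)"
  have comp_eq: "\<Gamma> p (qs[i := f]) = (\<Sum>ks | set ks \<subseteq> ?K \<and> length ks = length qs.
      Poly_Mapping.single (sum_list ks)
        (\<gamma> ks p ((map2 Poly_Mapping.lookup qs ks)[i := Poly_Mapping.lookup f (ks ! i)])))"
    if f: "f \<in> V" "Poly_Mapping.keys f \<subseteq> ?K" for f
    by (rule full_comp_list_update) (use assms f in auto)
  have *: "\<gamma> ks p ((map2 Poly_Mapping.lookup qs ks)[i := Poly_Mapping.lookup (scl c q) (ks ! i)])
      = scale c (\<gamma> ks p ((map2 Poly_Mapping.lookup qs ks)[i := Poly_Mapping.lookup q (ks ! i)]))"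
    if "length ks = length qs" for ks
    unfolding lookup_scale_sum
    by (rule comp_scale_inner) (use assms that in \<open>auto intro!: components_in simp: operad_sum_iff\<close>)
  have "Poly_Mapping.keys (scl c q) \<subseteq> ?K"
    by (auto simp: in_keys_iff lookup_scale_sum)
  then show ?thesis
    by (subst (1 2) comp_eq) (use assms in \<open>auto simp: V_scale sum.scale_sum_right scl_single * intro!: sum.cong\<close>)
qed

text \<open>Any list of arities other than \<open>ks\<close> picks a zero component somewhere, so a
  single term survives.\<close>

lemma full_comp_single:
  assumes p: "p \<in> P (length ks)" and xs: "list_all2 (\<lambda>k x. x \<in> P k) ks xs"
  shows "\<Gamma> p (map2 Poly_Mapping.single ks xs) = Poly_Mapping.single (sum_list ks) (\<gamma> ks p xs)"
proof -
  let ?qs = "map2 Poly_Mapping.single ks xs"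
  have len: "length xs = length ks"
    using xs by (simp add: list_all2_lengthD)
  have sub: "set ?qs \<subseteq> V"
    using xs len by (auto simp: in_set_conv_nth list_all2_conv_all_nth V_single)
  have keys: "Poly_Mapping.keys q \<subseteq> set ks" if "q \<in> set ?qs" for q
    using that by (auto simp: set_zip split: if_splits)
  \<comment> \<open>With \<open>set ks\<close> as the common support, \<open>ks\<close> is in the
    index set even when some entry of \<open>xs\<close> is zero and has empty support.\<close>
  have "\<Gamma> p ?qs = (\<Sum>ls | set ls \<subseteq> set ks \<and> length ls = length ?qs.
      Poly_Mapping.single (sum_list ls) (\<gamma> ls p (map2 Poly_Mapping.lookup ?qs ls)))"
    by (rule full_comp_eq_sum) (use p len sub keys in simp_all)
  also have "\<dots> = (\<Sum>ls\<in>{ks}.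
      Poly_Mapping.single (sum_list ls) (\<gamma> ls p (map2 Poly_Mapping.lookup ?qs ls)))"
  proof (rule sum.mono_neutral_right)
    show "finite {ls. set ls \<subseteq> set ks \<and> length ls = length ?qs}"
      by (rule finite_lists_length_eq) simp
    show "\<forall>ls\<in>{ls. set ls \<subseteq> set ks \<and> length ls = length ?qs} - {ks}.
      Poly_Mapping.single (sum_list ls) (\<gamma> ls p (map2 Poly_Mapping.lookup ?qs ls)) = 0"
    proof
      fix ls assume "ls \<in> {ls. set ls \<subseteq> set ks \<and> length ls = length ?qs} - {ks}"
      then have ls: "length ls = length ks" "ls \<noteq> ks"
        using len by auto
      then obtain i where i: "i < length ks" "ls ! i \<noteq> ks ! i"
        by (metis nth_equalityI)
      have "\<gamma> ls p (map2 Poly_Mapping.lookup ?qs ls) = 0"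
        by (rule comp_zero_inner[where i=i])
          (use ls i len p sub in \<open>auto intro!: components_in simp: lookup_single when_def\<close>)
      then show "Poly_Mapping.single (sum_list ls) (\<gamma> ls p (map2 Poly_Mapping.lookup ?qs ls)) = 0"
        by simp
    qed
  qed (use len in simp)
  also have "\<dots> = Poly_Mapping.single (sum_list ks) (\<gamma> ks p (map2 Poly_Mapping.lookup ?qs ks))"
    by simp
  also have "map2 Poly_Mapping.lookup ?qs ks = xs"
    by (rule nth_equalityI) (simp_all add: len)
  finally show ?thesis .
qed

section \<open>The product and its bilinearity\<close>

lemma insert_comp_eq: "insert_comp \<gamma> I n p is qs = \<Gamma> p (plug u n is qs)"
  by (simp add: insert_comp_def plug_def)

text \<open>The arity \<open>n\<close> is an explicit argument since \<open>p\<close> may lie in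
  several spaces of the family.\<close>

definition insertions :: "nat \<Rightarrow> 'v \<Rightarrow> (nat \<Rightarrow>\<^sub>0 'v) \<Rightarrow> nat \<Rightarrow>\<^sub>0 'v" where
  "insertions n p q = (\<Sum>i<n. \<Gamma> p ((replicate n u)[i := q]))"

lemma pl_eq_sum_keys:
  "pl f q = (\<Sum>n\<in>Poly_Mapping.keys f. insertions n (Poly_Mapping.lookup f n) q)"
proof -
  \<comment> \<open>Position \<open>Suc i\<close>, counted from 1, is index \<open>i\<close> of the
    list of units.\<close>
  have "plug u n [Suc i] [q] = (replicate n u)[i := q]" for n i
    using plug_snoc[of "[]" "[]" i u n q] by (simp add: plug_Nil)
  then show ?thesis
    by (simp add: pre_lie_prod_def insertions_def insert_comp_eq sum.atLeast1_atMost_eq One_nat_def)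
qed

lemma set_slot_subset: "q \<in> V \<Longrightarrow> set ((replicate n u)[i := q]) \<subseteq> V"
  by (rule set_update_subsetI) (auto simp: V_unit)

lemma insertions_closed: "\<lbrakk>p \<in> P n; q \<in> V\<rbrakk> \<Longrightarrow> insertions n p q \<in> V"
  unfolding insertions_def by (intro V_sum full_comp_closed) (simp_all add: set_slot_subset)

lemma insertions_add_left:
  "\<lbrakk>p \<in> P n; p' \<in> P n; q \<in> V\<rbrakk> \<Longrightarrow> insertions n (p + p') q = insertions n p q + insertions n p' q"
  by (simp add: insertions_def full_comp_add_outer set_slot_subset sum.distrib)

lemma insertions_scale_left:
  "\<lbrakk>p \<in> P n; q \<in> V\<rbrakk> \<Longrightarrow> insertions n (scale c p) q = scl c (insertions n p q)"
  by (simp add: insertions_def full_comp_scale_outer set_slot_subset sum.scale_sum_right)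

lemma insertions_zero: "q \<in> V \<Longrightarrow> insertions n 0 q = 0"
  using insertions_scale_left[of 0 n q 0] P_zero by simp

lemma insertions_add_right:
  assumes "p \<in> P n" "q \<in> V" "q' \<in> V"
  shows "insertions n p (q + q') = insertions n p q + insertions n p q'"
  using additive_slotsD[OF additive_slots_full_comp[OF assms(1)], of "replicate n u"] assms V_unit
  by (auto simp: insertions_def sum.distrib[symmetric] intro!: sum.cong)

lemma insertions_scale_right:
  assumes "p \<in> P n" "q \<in> V"
  shows "insertions n p (scl c q) = scl c (insertions n p q)"
  using assms V_unit
  by (auto simp: insertions_def sum.scale_sum_right full_comp_scale_inner intro!: sum.cong)

lemma pl_eq_sum:
  assumes "f \<in> V" "q \<in> V" "finite K" "Poly_Mapping.keys f \<subseteq> K"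
  shows "pl f q = (\<Sum>n\<in>K. insertions n (Poly_Mapping.lookup f n) q)"
  unfolding pl_eq_sum_keys
  by (rule sum.mono_neutral_left) (use assms in \<open>auto simp: in_keys_iff insertions_zero\<close>)

lemma pl_single: "\<lbrakk>p \<in> P n; q \<in> V\<rbrakk> \<Longrightarrow> pl (Poly_Mapping.single n p) q = insertions n p q"
  by (subst pl_eq_sum[where K="{n}"]) (auto simp: V_single split: if_splits)

lemma pl_closed: "\<lbrakk>f \<in> V; q \<in> V\<rbrakk> \<Longrightarrow> pl f q \<in> V"
  unfolding pl_eq_sum_keys by (intro V_sum insertions_closed lookup_in_P)

lemma pl_add_left:
  assumes "f \<in> V" "g \<in> V" "q \<in> V"
  shows "pl (f + g) q = pl f q + pl g q"
  using assms keys_add[of f g]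
  by (simp add: pl_eq_sum[where K="Poly_Mapping.keys f \<union> Poly_Mapping.keys g"] V_add lookup_add
      insertions_add_left lookup_in_P sum.distrib)

lemma pl_scale_left:
  assumes "f \<in> V" "q \<in> V"
  shows "pl (scl c f) q = scl c (pl f q)"
proof -
  have "Poly_Mapping.keys (scl c f) \<subseteq> Poly_Mapping.keys f"
    by (auto simp: in_keys_iff lookup_scale_sum)
  then show ?thesis
    using assms by (simp add: pl_eq_sum[where K="Poly_Mapping.keys f"] V_scale lookup_scale_sum
      insertions_scale_left lookup_in_P sum.scale_sum_right)
qed

lemma pl_add_right: "\<lbrakk>f \<in> V; q \<in> V; q' \<in> V\<rbrakk> \<Longrightarrow> pl f (q + q') = pl f q + pl f q'"
  by (simp add: pl_eq_sum_keys insertions_add_right lookup_in_P sum.distrib)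

lemma pl_scale_right: "\<lbrakk>f \<in> V; q \<in> V\<rbrakk> \<Longrightarrow> pl f (scl c q) = scl c (pl f q)"
  by (simp add: pl_eq_sum_keys insertions_scale_right lookup_in_P sum.scale_sum_right)

lemma pl_sum_left:
  assumes "finite X" "\<And>x. x \<in> X \<Longrightarrow> g x \<in> V" "q \<in> V"
  shows "pl (\<Sum>x\<in>X. g x) q = (\<Sum>x\<in>X. pl (g x) q)"
  using assms(1,2)
proof (induction X rule: finite_induct)
  case empty
  then show ?case
    using pl_scale_left[of 0 q 0] V_sum[of "{}"] assms(3) by simp
next
  case (insert x X)
  then show ?case
    by (simp add: pl_add_left V_sum assms(3))
qed

section \<open>Units and the product with a composite\<close>

lemma unit_comp:
  assumes "q \<in> V"
  shows "\<Gamma> I [q] = q"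
  using assms
proof (induction q rule: V_induct)
  case (single k x)
  then show ?case
    using full_comp_single[of I "[k]" "[x]"] unit_closed by (simp add: unit_left One_nat_def)
next
  case (add f g)
  then show ?case
    using additive_slotsD[OF additive_slots_full_comp[OF unit_closed], of "[f]" 0 f g] by simp
qed

text \<open>\<open>I\<close> has a single leaf, and filling it with \<open>q\<close> gives
  \<open>q\<close>. In \<open>pl_plug\<close> this makes a leaf still holding the unit receive the
  new argument itself.\<close>

lemma pl_unit: "q \<in> V \<Longrightarrow> pl u q = q"
  using pl_single[OF unit_closed] by (simp add: insertions_def unit_comp One_nat_def)

text \<open>Start of the recursion: this is the bracket without arguments.\<close>

lemma full_comp_units:
  assumes "p \<in> P n"
  shows "\<Gamma> p (replicate n u) = Poly_Mapping.single n p"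
  using full_comp_single[of p "replicate n 1" "replicate n I"] assms unit_closed
  by (simp add: unit_right list_all2_conv_all_nth sum_list_replicate zip_replicate map_replicate)

text \<open>Operad associativity with a third layer that consists of units except for
  \<open>y\<close> at one leaf. The blocks without \<open>y\<close> collapse by
  \<open>unit_right\<close>, so only argument \<open>j\<close> changes.\<close>

lemma full_comp_insert_block:
  assumes p: "p \<in> P (length ks)" and xs: "list_all2 (\<lambda>k x. x \<in> P k) ks xs"
    and y: "y \<in> P l" and j: "j < length ks" and t: "t < ks ! j"
  shows "\<Gamma> (\<gamma> ks p xs) ((replicate (sum_list ks) u)[sum_list (take j ks) + t := Poly_Mapping.single l y])
    = \<Gamma> p ((map2 Poly_Mapping.single ks xs)
        [j := \<Gamma> (xs ! j) ((replicate (ks ! j) u)[t := Poly_Mapping.single l y])])"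
proof -
  \<comment> \<open>\<open>L\<close> and \<open>Y\<close> are the arities and the elements put on
    the leaves of argument \<open>j\<close>. The lists \<open>ls\<close> and \<open>rs\<close>
    collect such blocks for all arguments, in the shape required by
    \<open>comp_assoc\<close>.\<close>
  define L where "L = (replicate (ks ! j) 1)[t := l]"
  define Y where "Y = (replicate (ks ! j) I)[t := y]"
  define ls where "ls = (map (\<lambda>k. replicate k 1) ks)[j := L]"
  define rs where "rs = (map (\<lambda>k. replicate k I) ks)[j := Y]"
  have len: "length xs = length ks"
    using xs by (simp add: list_all2_lengthD)
  have xj: "xs ! i \<in> P (ks ! i)" if "i < length ks" for i
    using xs that by (simp add: list_all2_conv_all_nth)
  have LY: "list_all2 (\<lambda>k x. x \<in> P k) L Y"
    using y unit_closed unfolding L_def Y_def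
    by (intro list_all2_update_cong) (simp_all add: list_all2_conv_all_nth)
  have block: "map2 Poly_Mapping.single ((replicate m 1)[i := l]) ((replicate m I)[i := y])
      = (replicate m u)[i := Poly_Mapping.single l y]" for m i
    by (simp add: zip_update map_update)
  have inner: "\<Gamma> (xs ! j) ((replicate (ks ! j) u)[t := Poly_Mapping.single l y])
      = Poly_Mapping.single (sum_list L) (\<gamma> L (xs ! j) Y)"
    using full_comp_single[of "xs ! j" L Y] xj[OF j] LY block[of "ks ! j" t] by (simp add: L_def Y_def)
  have inner_in: "\<gamma> L (xs ! j) Y \<in> P (sum_list L)"
    using xj[OF j] LY by (intro comp_closed) (simp_all add: L_def)
  have concat_ls: "concat ls = (replicate (sum_list ks) 1)[sum_list (take j ks) + t := l]"
    using concat_list_update[of j "map (\<lambda>k. replicate k 1) ks" t l] j t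
    by (simp add: ls_def L_def concat_map_replicate take_map comp_def)
  have concat_rs: "concat rs = (replicate (sum_list ks) I)[sum_list (take j ks) + t := y]"
    using concat_list_update[of j "map (\<lambda>k. replicate k I) ks" t y] j t
    by (simp add: rs_def Y_def concat_map_replicate take_map comp_def)
  have len_ls: "list_all2 (\<lambda>k l. length l = k) ks ls"
    using j by (auto simp: ls_def L_def list_all2_conv_all_nth nth_list_update)
  have ls_rs: "list_all2 (list_all2 (\<lambda>l r. r \<in> P l)) ls rs"
    using LY unit_closed j by (auto simp: ls_def rs_def list_all2_conv_all_nth nth_list_update)
  have flat: "list_all2 (\<lambda>k x. x \<in> P k) (concat ls) (concat rs)"
    using y unit_closed unfolding concat_ls concat_rs
    by (intro list_all2_update_cong) (simp_all add: list_all2_conv_all_nth)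
  have sum_ls: "map sum_list ls = ks[j := sum_list L]"
    by (rule nth_equalityI) (use j in \<open>auto simp: ls_def nth_list_update sum_list_replicate\<close>)
  \<comment> \<open>The blocks other than \<open>j\<close> hold units only, so
    \<open>unit_right\<close> leaves those arguments unchanged.\<close>
  have comps: "map (\<lambda>(l, q, r). \<gamma> l q r) (zip ls (zip xs rs)) = xs[j := \<gamma> L (xs ! j) Y]"
    by (rule nth_equalityI)
      (use j len xj in \<open>auto simp: ls_def rs_def nth_list_update unit_right\<close>)
  have "\<Gamma> (\<gamma> ks p xs) ((replicate (sum_list ks) u)[sum_list (take j ks) + t := Poly_Mapping.single l y])
      = Poly_Mapping.single (sum_list (concat ls)) (\<gamma> (concat ls) (\<gamma> ks p xs) (concat rs))"
    using full_comp_single[OF _ flat, of "\<gamma> ks p xs"] comp_closed[OF p xs] block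
    by (simp add: concat_ls concat_rs)
  also have "\<dots> = Poly_Mapping.single (sum_list (ks[j := sum_list L]))
      (\<gamma> (ks[j := sum_list L]) p (xs[j := \<gamma> L (xs ! j) Y]))"
    using comp_assoc[OF p xs len_ls ls_rs] by (simp add: sum_list_concat sum_ls comps)
  also have "\<dots> = \<Gamma> p (map2 Poly_Mapping.single (ks[j := sum_list L]) (xs[j := \<gamma> L (xs ! j) Y]))"
    using p xs inner_in
    by (intro full_comp_single[symmetric] list_all2_update_cong) simp_all
  also have "map2 Poly_Mapping.single (ks[j := sum_list L]) (xs[j := \<gamma> L (xs ! j) Y])
      = (map2 Poly_Mapping.single ks xs)[j := Poly_Mapping.single (sum_list L) (\<gamma> L (xs ! j) Y)]"
    by (simp add: zip_update map_update)
  finally show ?thesis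
    by (simp add: inner)
qed

text \<open>Each leaf of the composite lies on exactly one inner argument. Grouping the insertions
  of \<open>r\<close> by that argument produces its product with \<open>r\<close>.\<close>

lemma pl_full_comp_homogeneous:
  assumes p: "p \<in> P (length ks)" and xs: "list_all2 (\<lambda>k x. x \<in> P k) ks xs" and r: "r \<in> V"
  shows "pl (\<Gamma> p (map2 Poly_Mapping.single ks xs)) r
    = (\<Sum>j<length ks. \<Gamma> p ((map2 Poly_Mapping.single ks xs)[j := pl (Poly_Mapping.single (ks ! j) (xs ! j)) r]))"
  using r
proof (induction r rule: V_induct)
  case (single l y)
  let ?r = "Poly_Mapping.single l y" and ?qs = "map2 Poly_Mapping.single ks xs"
  have rV: "?r \<in> V"
    using single by (rule V_single)
  have len: "length xs = length ks"
    using xs by (simp add: list_all2_lengthD)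
  have xj: "xs ! j \<in> P (ks ! j)" if "j < length ks" for j
    using xs that by (simp add: list_all2_conv_all_nth)
  have sub: "set ?qs \<subseteq> V"
    using xj len by (auto simp: in_set_conv_nth V_single)
  have "pl (\<Gamma> p ?qs) ?r = insertions (sum_list ks) (\<gamma> ks p xs) ?r"
    using comp_closed[OF p xs] rV by (simp add: full_comp_single[OF p xs] pl_single)
  also have "\<dots> = (\<Sum>j<length ks. \<Sum>t<ks ! j.
      \<Gamma> (\<gamma> ks p xs) ((replicate (sum_list ks) u)[sum_list (take j ks) + t := ?r]))"
    by (simp add: insertions_def sum_lessThan_sum_list)
  also have "\<dots> = (\<Sum>j<length ks. \<Sum>t<ks ! j.
      \<Gamma> p (?qs[j := \<Gamma> (xs ! j) ((replicate (ks ! j) u)[t := ?r])]))"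
    using full_comp_insert_block[OF p xs single] by simp
  \<comment> \<open>Additivity in slot \<open>j\<close> moves the sum over the leaves of argument
    \<open>j\<close> inside the composition.\<close>
  also have "\<dots> = (\<Sum>j<length ks. \<Gamma> p (?qs[j := insertions (ks ! j) (xs ! j) ?r]))"
    unfolding insertions_def using len xj rV
    by (intro sum.cong refl additive_slots_sum[OF additive_slots_full_comp[OF p] _ sub, symmetric] full_comp_closed)
      (simp_all add: set_slot_subset)
  also have "\<dots> = (\<Sum>j<length ks. \<Gamma> p (?qs[j := pl (Poly_Mapping.single (ks ! j) (xs ! j)) ?r]))"
    using xj rV by (simp add: pl_single)
  finally show ?case .
next
  case (add f g)
  have len: "length xs = length ks"
    using xs by (simp add: list_all2_lengthD)
  have xj: "Poly_Mapping.single (ks ! j) (xs ! j) \<in> V" if "j < length ks" for j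
    using xs that by (simp add: list_all2_conv_all_nth V_single)
  have sub: "set (map2 Poly_Mapping.single ks xs) \<subseteq> V"
    using xj len by (auto simp: in_set_conv_nth)
  show ?case
    using add additive_slotsD[OF additive_slots_full_comp[OF p] _ sub] xj len
      full_comp_closed[OF _ sub, of p] p
    by (simp add: pl_add_right pl_closed sum.distrib)
qed

text \<open>Both sides are additive in each slot of \<open>qs\<close>, so the homogeneous case
  suffices.\<close>

lemma pl_full_comp:
  assumes "p \<in> P n" "length qs = n" "set qs \<subseteq> V" "r \<in> V"
  shows "pl (\<Gamma> p qs) r = (\<Sum>j<n. \<Gamma> p (qs[j := pl (qs ! j) r]))"
proof (rule additive_slots_eqI[of n "\<lambda>qs. pl (\<Gamma> p qs) r" "\<lambda>qs. \<Sum>j<n. \<Gamma> p (qs[j := pl (qs ! j) r])"])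
  note slots = additive_slotsD[OF additive_slots_full_comp[OF assms(1)]]
  show "additive_slots V n (\<lambda>qs. pl (\<Gamma> p qs) r)"
    unfolding additive_slots_def
  proof (intro allI impI, elim conjE)
    fix qs i q q'
    assume qs: "length qs = n" "set qs \<subseteq> V" "i < n" "q \<in> V" "q' \<in> V"
    then have "set (qs[i := q]) \<subseteq> V" "set (qs[i := q']) \<subseteq> V"
      by (simp_all add: set_update_subsetI)
    then show "pl (\<Gamma> p (qs[i := q + q'])) r = pl (\<Gamma> p (qs[i := q])) r + pl (\<Gamma> p (qs[i := q'])) r"
      using qs assms(1,4) by (simp add: slots pl_add_left full_comp_closed)
  qed
  show "additive_slots V n (\<lambda>qs. \<Sum>j<n. \<Gamma> p (qs[j := pl (qs ! j) r]))"
    unfolding additive_slots_def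
  proof (intro allI impI, elim conjE)
    fix qs i q q'
    assume qs: "length qs = n" "set qs \<subseteq> V" "i < n" "q \<in> V" "q' \<in> V"
    have "\<Gamma> p (qs[i := q + q', j := pl (qs[i := q + q'] ! j) r])
        = \<Gamma> p (qs[i := q, j := pl (qs[i := q] ! j) r]) + \<Gamma> p (qs[i := q', j := pl (qs[i := q'] ! j) r])"
      if j: "j < n" for j
    \<comment> \<open>For \<open>j = i\<close> the slot holds a product with left factor
      \<open>q + q'\<close>, which splits by additivity of the product. Otherwise the two updates
      concern different slots and commute.\<close>
    proof (cases "j = i")
      case True
      then show ?thesis
        using qs assms(4) by (simp add: pl_add_left pl_closed slots)
    next
      case False
      have "qs ! j \<in> V"
        using qs j by auto
      then have "set (qs[j := pl (qs ! j) r]) \<subseteq> V"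
        using qs assms(4) by (intro set_update_subsetI pl_closed)
      then show ?thesis
        using False slots[of "qs[j := pl (qs ! j) r]" i q q'] qs
        by (simp add: list_update_swap[of i j])
    qed
    then show "(\<Sum>j<n. \<Gamma> p (qs[i := q + q', j := pl (qs[i := q + q'] ! j) r]))
        = (\<Sum>j<n. \<Gamma> p (qs[i := q, j := pl (qs[i := q] ! j) r]))
        + (\<Sum>j<n. \<Gamma> p (qs[i := q', j := pl (qs[i := q'] ! j) r]))"
      by (simp add: sum.distrib)
  qed
  fix qs :: "(nat \<Rightarrow>\<^sub>0 'v) list"
  assume qs: "length qs = n" "set qs \<subseteq> homogeneous"
  then have "\<forall>j. \<exists>k x. j < n \<longrightarrow> x \<in> P k \<and> qs ! j = Poly_Mapping.single k x"
    by (metis (no_types, lifting) UN_E homogeneous_def imageE nth_mem subsetD)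
  then obtain k x where kx: "\<And>j. j < n \<Longrightarrow> x j \<in> P (k j) \<and> qs ! j = Poly_Mapping.single (k j) (x j)"
    by metis
  let ?ks = "map k [0..<n]" and ?xs = "map x [0..<n]"
  have eq: "qs = map2 Poly_Mapping.single ?ks ?xs"
    by (rule nth_equalityI) (use qs kx in auto)
  have xs: "list_all2 (\<lambda>k x. x \<in> P k) ?ks ?xs"
    using kx by (simp add: list_all2_conv_all_nth)
  show "pl (\<Gamma> p qs) r = (\<Sum>j<n. \<Gamma> p (qs[j := pl (qs ! j) r]))"
    using pl_full_comp_homogeneous[OF _ xs assms(4), of p] assms(1) kx by (simp add: eq[symmetric])
qed (use assms in simp_all)

section \<open>Sums over placements and the brackets\<close>

definition symmetric_brace :: "nat \<Rightarrow> 'v \<Rightarrow> (nat \<Rightarrow>\<^sub>0 'v) list \<Rightarrow> nat \<Rightarrow>\<^sub>0 'v" where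
  "symmetric_brace n p qs = (\<Sum>is\<in>placements n (length qs). \<Gamma> p (plug u n is qs))"

lemma plug_subset: "set qs \<subseteq> V \<Longrightarrow> set (plug u n is qs) \<subseteq> V"
  by (rule set_plug_subset[OF V_unit])

lemma symmetric_brace_closed: "\<lbrakk>p \<in> P n; set qs \<subseteq> V\<rbrakk> \<Longrightarrow> symmetric_brace n p qs \<in> V"
  unfolding symmetric_brace_def by (intro V_sum full_comp_closed plug_subset) simp_all

lemma symmetric_brace_add_left:
  "\<lbrakk>p \<in> P n; p' \<in> P n; set qs \<subseteq> V\<rbrakk>
    \<Longrightarrow> symmetric_brace n (p + p') qs = symmetric_brace n p qs + symmetric_brace n p' qs"
  by (simp add: symmetric_brace_def full_comp_add_outer plug_subset sum.distrib)

lemma symmetric_brace_scale_left: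
  "\<lbrakk>p \<in> P n; set qs \<subseteq> V\<rbrakk> \<Longrightarrow> symmetric_brace n (scale c p) qs = scl c (symmetric_brace n p qs)"
  by (simp add: symmetric_brace_def full_comp_scale_outer plug_subset sum.scale_sum_right)

lemma symmetric_brace_zero: "set qs \<subseteq> V \<Longrightarrow> symmetric_brace n 0 qs = 0"
  using symmetric_brace_scale_left[of 0 n qs 0] P_zero by simp

lemma placementsD:
  assumes "is \<in> placements n (length qs)"
  shows "length is = length qs" "distinct is" "set is \<subseteq> {1..n}"
  using assms by (simp_all add: placements_def)

lemma placement_nth:
  assumes "is \<in> placements n k" "i < k"
  obtains j where "is ! i = Suc j" "j < n"
proof -
  have "is ! i \<in> {1..n}"
    using assms by (auto simp: placements_def simp del: atLeastAtMost_iff intro: nth_mem)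
  then show thesis
    using that by (cases "is ! i") (auto simp: One_nat_def)
qed

text \<open>In a fixed placement, slot \<open>i\<close> of \<open>qs\<close> is one slot of the
  filled list, so additivity of the composition applies term by term.\<close>

lemma symmetric_brace_add_right:
  assumes "p \<in> P n" "set qs \<subseteq> V" "i < length qs" "q \<in> V" "q' \<in> V"
  shows "symmetric_brace n p (qs[i := q + q'])
    = symmetric_brace n p (qs[i := q]) + symmetric_brace n p (qs[i := q'])"
proof -
  have "\<Gamma> p (plug u n is (qs[i := q + q']))
      = \<Gamma> p (plug u n is (qs[i := q])) + \<Gamma> p (plug u n is (qs[i := q']))"
    if "is": "is \<in> placements n (length qs)" for "is"
  proof -
    obtain j where j: "is ! i = Suc j" "j < n"
      using placement_nth[OF "is" assms(3)] .
    show ?thesis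
      using plug_list_update[OF placementsD(1,2)[OF "is"] _ j(1)] assms placementsD(1)[OF "is"]
        additive_slotsD[OF additive_slots_full_comp[OF assms(1)] length_plug plug_subset[OF assms(2)] j(2)]
      by simp
  qed
  then show ?thesis
    by (simp add: symmetric_brace_def sum.distrib)
qed

lemma symmetric_brace_scale_right:
  assumes "p \<in> P n" "set qs \<subseteq> V" "i < length qs" "q \<in> V"
  shows "symmetric_brace n p (qs[i := scl c q]) = scl c (symmetric_brace n p (qs[i := q]))"
proof -
  have "\<Gamma> p (plug u n is (qs[i := scl c q])) = scl c (\<Gamma> p (plug u n is (qs[i := q])))"
    if "is": "is \<in> placements n (length qs)" for "is"
  proof -
    obtain j where j: "is ! i = Suc j" "j < n"
      using placement_nth[OF "is" assms(3)] .
    show ?thesis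
      using plug_list_update[OF placementsD(1,2)[OF "is"] _ j(1)] assms placementsD(1)[OF "is"]
        full_comp_scale_inner[OF _ plug_subset[OF assms(2)]] j(2)
      by simp
  qed
  then show ?thesis
    by (simp add: symmetric_brace_def sum.scale_sum_right)
qed

lemma symmetric_brace_mset_eq:
  "mset qs = mset rs \<Longrightarrow> symmetric_brace n p qs = symmetric_brace n p rs"
  unfolding symmetric_brace_def by (rule sum_placements_mset_eq)

text \<open>Inserting \<open>r\<close> at a slot of the filled list hits either a free position,
  where it extends the placement, or an occupied one, where it multiplies the argument sitting
  there.\<close>

lemma pl_plug:
  assumes p: "p \<in> P n" and qs: "set qs \<subseteq> V" and r: "r \<in> V"
    and "is": "is \<in> placements n (length qs)"
  shows "pl (\<Gamma> p (plug u n is qs)) r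
    = (\<Sum>j\<in>{1..n} - set is. \<Gamma> p (plug u n (is @ [j]) (qs @ [r])))
      + (\<Sum>i<length qs. \<Gamma> p (plug u n is (qs[i := pl (qs ! i) r])))"
proof -
  note isD = placementsD[OF "is"]
  \<comment> \<open>Positions start at 1 and list indices at 0, hence \<open>j - 1\<close>.\<close>
  let ?h = "\<lambda>j. \<Gamma> p ((plug u n is qs)[j - 1 := pl (plug u n is qs ! (j - 1)) r])"
  have "pl (\<Gamma> p (plug u n is qs)) r = (\<Sum>j\<in>{1..n}. ?h j)"
    using pl_full_comp[OF p length_plug plug_subset[OF qs] r]
    by (simp add: sum.atLeast1_atMost_eq One_nat_def)
  also have "\<dots> = (\<Sum>j\<in>{1..n} - set is. ?h j) + (\<Sum>j\<in>set is. ?h j)"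
    using isD(3) by (rule sum.subset_diff) simp
  \<comment> \<open>A free position holds \<open>u\<close>, and \<open>pl u r = r\<close>, so the
    update places \<open>r\<close> itself at \<open>j\<close>.\<close>
  also have "(\<Sum>j\<in>{1..n} - set is. ?h j) = (\<Sum>j\<in>{1..n} - set is. \<Gamma> p (plug u n (is @ [j]) (qs @ [r])))"
  proof (rule sum.cong)
    fix j assume "j \<in> {1..n} - set is"
    then obtain l where l: "j = Suc l" "l < n" "Suc l \<notin> set is"
      by (cases j) auto
    then show "?h j = \<Gamma> p (plug u n (is @ [j]) (qs @ [r]))"
      using isD(1,2) r by (simp add: plug_snoc nth_plug_notin pl_unit)
  qed simp
  \<comment> \<open>By distinctness the occupied positions correspond bijectively to the
    arguments.\<close>
  also have "(\<Sum>j\<in>set is. ?h j) = (\<Sum>i<length qs. ?h (is ! i))"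
    using sum.reindex_bij_betw[OF bij_betw_nth[OF isD(2) refl refl], of ?h] isD(1) by simp
  also have "\<dots> = (\<Sum>i<length qs. \<Gamma> p (plug u n is (qs[i := pl (qs ! i) r])))"
  proof (rule sum.cong)
    fix i assume i: "i \<in> {..<length qs}"
    then obtain l where l: "is ! i = Suc l" "l < n"
      using placement_nth[OF "is", of i] by auto
    then show "?h (is ! i) = \<Gamma> p (plug u n is (qs[i := pl (qs ! i) r]))"
      using isD i plug_list_update[OF isD(1,2) _ l(1)] nth_plug_in[OF isD(1,2) _ l] by simp
  qed simp
  finally show ?thesis .
qed

text \<open>This is \<open>pl_plug\<close> summed over all placements. Solved for the first term on
  the right, it is the recursion that defines \<open>brace\<close>.\<close>

lemma pl_symmetric_brace:
  assumes "p \<in> P n" "set qs \<subseteq> V" "r \<in> V"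
  shows "pl (symmetric_brace n p qs) r
    = symmetric_brace n p (qs @ [r]) + (\<Sum>i<length qs. symmetric_brace n p (qs[i := pl (qs ! i) r]))"
proof -
  have "pl (symmetric_brace n p qs) r = (\<Sum>is\<in>placements n (length qs). pl (\<Gamma> p (plug u n is qs)) r)"
    unfolding symmetric_brace_def using assms
    by (intro pl_sum_left finite_placements full_comp_closed plug_subset) simp_all
  also have "\<dots> = (\<Sum>is\<in>placements n (length qs).
        \<Sum>j\<in>{1..n} - set is. \<Gamma> p (plug u n (is @ [j]) (qs @ [r])))
      + (\<Sum>is\<in>placements n (length qs). \<Sum>i<length qs. \<Gamma> p (plug u n is (qs[i := pl (qs ! i) r])))"
    using assms by (simp add: pl_plug sum.distrib)
  also have "(\<Sum>is\<in>placements n (length qs).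
        \<Sum>j\<in>{1..n} - set is. \<Gamma> p (plug u n (is @ [j]) (qs @ [r]))) = symmetric_brace n p (qs @ [r])"
    by (simp add: symmetric_brace_def sum_placements_Suc)
  also have "(\<Sum>is\<in>placements n (length qs). \<Sum>i<length qs. \<Gamma> p (plug u n is (qs[i := pl (qs ! i) r])))
      = (\<Sum>i<length qs. symmetric_brace n p (qs[i := pl (qs ! i) r]))"
    by (subst sum.swap) (simp add: symmetric_brace_def)
  finally show ?thesis .
qed

text \<open>Both sides satisfy the same recursion in the last argument. Induction on the length
  makes the hypothesis apply also to the shorter list with one entry multiplied by the last
  argument.\<close>

lemma brace_eq:
  assumes "f \<in> V" "set qs \<subseteq> V"
  shows "brace pl f qs = (\<Sum>n\<in>Poly_Mapping.keys f. symmetric_brace n (Poly_Mapping.lookup f n) qs)"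
  using assms(2)
proof (induction "length qs" arbitrary: qs)
  case 0
  then show ?case
    using assms(1) poly_mapping_sum_single[of "Poly_Mapping.keys f" f]
    by (simp add: symmetric_brace_def placements_0 plug_Nil full_comp_units lookup_in_P)
next
  case (Suc k)
  then obtain rs r where qs: "qs = rs @ [r]" "length rs = k" "set rs \<subseteq> V" "r \<in> V"
    by (cases qs rule: rev_cases) auto
  have sub: "set (rs[i := pl (rs ! i) r]) \<subseteq> V" if "i < k" for i
    using qs that by (intro set_update_subsetI pl_closed) auto
  let ?S = "\<lambda>qs n. symmetric_brace n (Poly_Mapping.lookup f n) qs"
  let ?K = "Poly_Mapping.keys f"
  have "brace pl f qs = pl (\<Sum>n\<in>?K. ?S rs n) r - (\<Sum>i<k. \<Sum>n\<in>?K. ?S (rs[i := pl (rs ! i) r]) n)"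
    using qs Suc.hyps(1) sub by simp
  also have "pl (\<Sum>n\<in>?K. ?S rs n) r = (\<Sum>n\<in>?K. pl (?S rs n) r)"
    using assms qs by (intro pl_sum_left symmetric_brace_closed lookup_in_P) simp_all
  also have "\<dots> = (\<Sum>n\<in>?K. ?S qs n) + (\<Sum>i<k. \<Sum>n\<in>?K. ?S (rs[i := pl (rs ! i) r]) n)"
    using assms qs by (subst sum.swap) (simp add: pl_symmetric_brace lookup_in_P sum.distrib)
  finally show ?case
    by simp
qed

lemma brace_eq_sum:
  assumes "f \<in> V" "set qs \<subseteq> V" "finite K" "Poly_Mapping.keys f \<subseteq> K"
  shows "brace pl f qs = (\<Sum>n\<in>K. symmetric_brace n (Poly_Mapping.lookup f n) qs)"
  unfolding brace_eq[OF assms(1,2)]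
  by (rule sum.mono_neutral_left) (use assms in \<open>auto simp: in_keys_iff symmetric_brace_zero\<close>)

lemma brace_single:
  "\<lbrakk>p \<in> P n; set qs \<subseteq> V\<rbrakk> \<Longrightarrow> brace pl (Poly_Mapping.single n p) qs = symmetric_brace n p qs"
  by (subst brace_eq_sum[where K="{n}"]) (auto simp: V_single split: if_splits)

lemma brace_mset_eq:
  assumes "f \<in> V" "set qs \<subseteq> V" "mset qs = mset rs"
  shows "brace pl f qs = brace pl f rs"
  using assms symmetric_brace_mset_eq[OF assms(3)] mset_eq_setD[OF assms(3)] by (simp add: brace_eq)

text \<open>The recursion of \<open>brace\<close> singles out the last argument and hides the
  symmetry. Symmetry and linearity are read off the explicit sum over placements instead.\<close>

lemma brace_defines_map: "defines_map_on_symmetric_algebra scl V (brace pl)"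
  unfolding defines_map_on_symmetric_algebra_def
proof (intro conjI ballI allI impI)
  fix f qs assume fq: "f \<in> V" "qs \<in> lists V"
  then have qs: "set qs \<subseteq> V"
    by auto
  show "brace pl f qs \<in> V"
    using fq(1) qs by (auto simp: brace_eq intro!: V_sum symmetric_brace_closed lookup_in_P)
  show "brace pl (f + g) qs = brace pl f qs + brace pl g qs" if "g \<in> V" for g
    using fq(1) qs that keys_add[of f g]
    by (simp add: brace_eq_sum[where K="Poly_Mapping.keys f \<union> Poly_Mapping.keys g"] V_add lookup_add
      symmetric_brace_add_left lookup_in_P sum.distrib)
  show "brace pl (scl c f) qs = scl c (brace pl f qs)" for c
  proof -
    have "Poly_Mapping.keys (scl c f) \<subseteq> Poly_Mapping.keys f"
      by (auto simp: in_keys_iff lookup_scale_sum)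
    then show ?thesis
      using fq(1) qs by (simp add: brace_eq_sum[where K="Poly_Mapping.keys f"] V_scale lookup_scale_sum
        symmetric_brace_scale_left lookup_in_P sum.scale_sum_right)
  qed
  have sub: "set (qs[i := q]) \<subseteq> V" if "q \<in> V" for i q
    using qs that by (rule set_update_subsetI)
  show "brace pl f (qs[i := q + q']) = brace pl f (qs[i := q]) + brace pl f (qs[i := q'])"
    if "i < length qs" "q \<in> V" "q' \<in> V" for i q q'
    using fq(1) qs that by (simp add: brace_eq sub V_add symmetric_brace_add_right lookup_in_P sum.distrib)
  show "brace pl f (qs[i := scl c q]) = scl c (brace pl f (qs[i := q]))"
    if "i < length qs" "q \<in> V" for i q c
    using fq(1) qs that
    by (simp add: brace_eq sub V_scale symmetric_brace_scale_right lookup_in_P sum.scale_sum_right)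
  show "brace pl f qs = brace pl f rs" if "mset qs = mset rs" for rs
    using fq(1) qs that by (rule brace_mset_eq)
qed

text \<open>There is no circularity: \<open>brace\<close> is defined for any product, and its
  symmetry was obtained from the sum over placements. For two arguments this symmetry is the
  identity up to sign.\<close>

lemma pl_pre_lie:
  assumes "x \<in> V" "y \<in> V" "z \<in> V"
  shows "pl x (pl y z) - pl (pl x y) z = pl x (pl z y) - pl (pl x z) y"
proof -
  have brace2: "brace pl x [a, b] = pl (pl x a) b - pl x (pl a b)" for a b
    using brace.simps(2)[of pl x "[]"] brace.simps(2)[of pl x "[a]" b] by simp
  have "brace pl x [y, z] = brace pl x [z, y]"
    using assms by (intro brace_mset_eq) simp_all
  then show ?thesis
    by (simp add: brace2 algebra_simps)
qed

lemma right_pre_lie_algebra_operad_sum: "right_pre_lie_algebra scl V pl"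
  by unfold_locales
    (simp_all add: subspace_V pl_closed pl_add_left pl_scale_left pl_add_right pl_scale_right pl_pre_lie)

section \<open>The grading\<close>

lemma single_eq_0_iff: "Poly_Mapping.single n x = 0 \<longleftrightarrow> x = 0"
  by (metis lookup_single_eq lookup_zero single_zero)

lemma degree_decomposition:
  assumes "x \<in> V"
  shows "\<exists>!f. (\<forall>d. f d \<in> degree_part P d) \<and> finite {d. f d \<noteq> 0} \<and> x = (\<Sum>d | f d \<noteq> 0. f d)"
proof -
  \<comment> \<open>Degree \<open>d\<close> is arity \<open>Suc d\<close>.\<close>
  define F where "F d = Poly_Mapping.single (Suc d) (Poly_Mapping.lookup x (Suc d))" for d
  have x0: "Poly_Mapping.lookup x 0 = 0"
    using assms by (simp add: operad_sum_def)
  have supp: "{d. F d \<noteq> 0} = Suc -` Poly_Mapping.keys x"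
    by (auto simp: F_def in_keys_iff single_eq_0_iff)
  have fin: "finite {d. F d \<noteq> 0}"
    unfolding supp by (rule finite_vimageI) simp_all
  \<comment> \<open>The component of arity 0 vanishes, so every arity in the support is a successor
    and no component is lost by the shift.\<close>
  have "Suc ` {d. F d \<noteq> 0} = Poly_Mapping.keys x"
  proof -
    have "n \<in> range Suc" if "n \<in> Poly_Mapping.keys x" for n
      using that x0 by (cases n) (simp_all add: in_keys_iff)
    then show ?thesis
      unfolding supp image_vimage_eq by blast
  qed
  then have "(\<Sum>n\<in>Poly_Mapping.keys x. Poly_Mapping.single n (Poly_Mapping.lookup x n)) = (\<Sum>d | F d \<noteq> 0. F d)"
    using sum.reindex[of Suc "{d. F d \<noteq> 0}" "\<lambda>n. Poly_Mapping.single n (Poly_Mapping.lookup x n)"]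
    by (simp add: F_def comp_def)
  then have sum: "x = (\<Sum>d | F d \<noteq> 0. F d)"
    using poly_mapping_sum_single[OF finite_keys order.refl, of x] by argo
  show ?thesis
  proof (rule ex1I[of _ F])
    have "F d \<in> degree_part P d" for d
      using assms by (simp add: F_def degree_part_def lookup_in_P)
    then show "(\<forall>d. F d \<in> degree_part P d) \<and> finite {d. F d \<noteq> 0} \<and> x = (\<Sum>d | F d \<noteq> 0. F d)"
      using fin sum by blast
    fix g assume g: "(\<forall>d. g d \<in> degree_part P d) \<and> finite {d. g d \<noteq> 0} \<and> x = (\<Sum>d | g d \<noteq> 0. g d)"
    then have "\<forall>d. \<exists>y. g d = Poly_Mapping.single (Suc d) y"
      by (auto simp only: degree_part_def)
    then obtain a where a: "\<And>d. g d = Poly_Mapping.single (Suc d) (a d)"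
      by metis
    have x: "x = (\<Sum>d | g d \<noteq> 0. g d)" and fin_g: "finite {d. g d \<noteq> 0}"
      using g by simp_all
    \<comment> \<open>Uniqueness: the component of \<open>x\<close> in arity \<open>Suc e\<close>
      determines the degree \<open>e\<close> part of any decomposition.\<close>
    have "Poly_Mapping.lookup x (Suc e) = a e" for e
    proof -
      have "Poly_Mapping.lookup x (Suc e) = (\<Sum>d | g d \<noteq> 0. Poly_Mapping.lookup (g d) (Suc e))"
        using arg_cong[OF x, of "\<lambda>f. Poly_Mapping.lookup f (Suc e)"] by (simp only: lookup_sum)
      also have "\<dots> = (\<Sum>d | g d \<noteq> 0. if d = e then a e else 0)"
        by (rule sum.cong) (auto simp: a lookup_single when_def)
      \<comment> \<open>If \<open>a e = 0\<close>, then \<open>e\<close> is missing from the index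
        set, and the sum is 0, which again equals \<open>a e\<close>.\<close>
      also have "\<dots> = a e"
        using fin_g by (simp add: a single_eq_0_iff)
      finally show ?thesis .
    qed
    then show "g = F"
      by (intro ext) (simp add: F_def a)
  qed
qed

lemma degree_part_subspace: "sum.subspace (degree_part P d)"
  unfolding sum.subspace_def degree_part_def
proof (intro conjI ballI allI)
  show "0 \<in> Poly_Mapping.single (Suc d) ` P (Suc d)"
    using imageI[OF P_zero, of "Poly_Mapping.single (Suc d)" "Suc d"] by simp
qed (auto simp: scl_single single_add[symmetric] P_add P_scale)

lemma degree_part_subset: "degree_part P d \<subseteq> V"
  by (auto simp: degree_part_def V_single)

lemma pl_degree:
  assumes "x \<in> degree_part P d" "y \<in> degree_part P e"
  shows "pl x y \<in> degree_part P (d + e)"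
proof -
  obtain p q where pq: "p \<in> P (Suc d)" "q \<in> P (Suc e)"
    "x = Poly_Mapping.single (Suc d) p" "y = Poly_Mapping.single (Suc e) q"
    using assms by (auto simp: degree_part_def)
  have "\<Gamma> p ((replicate (Suc d) u)[i := y]) \<in> degree_part P (d + e)" if i: "i < Suc d" for i
  proof -
    let ?ks = "(replicate (Suc d) 1)[i := Suc e]" and ?xs = "(replicate (Suc d) I)[i := q]"
    have xs: "list_all2 (\<lambda>k x. x \<in> P k) ?ks ?xs"
      using pq(2) unit_closed by (intro list_all2_update_cong) (simp_all add: list_all2_conv_all_nth del: replicate_Suc)
    have "map2 Poly_Mapping.single ?ks ?xs = (replicate (Suc d) u)[i := y]"
      by (simp add: zip_update map_update pq(4) del: replicate_Suc)
    \<comment> \<open>One of the \<open>Suc d\<close> entries 1 becomes \<open>Suc e\<close>, so the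
      total arity is \<open>d + Suc e\<close>.\<close>
    moreover have "sum_list ?ks = Suc (d + e)"
      using i by (simp add: sum_list_update sum_list_replicate One_nat_def del: replicate_Suc)
    ultimately show ?thesis
      using full_comp_single[OF _ xs, of p] comp_closed[OF _ xs, of p] pq(1)
      by (simp add: degree_part_def del: replicate_Suc)
  qed
  then have "insertions (Suc d) p y \<in> degree_part P (d + e)"
    unfolding insertions_def by (intro sum.subspace_sum[OF degree_part_subspace]) simp
  then show ?thesis
    using pq by (simp add: pl_single V_single)
qed

lemma graded_right_pre_lie_algebra_operad_sum:
  "graded_right_pre_lie_algebra scl V pl (degree_part P)"
proof -
  interpret right_pre_lie_algebra scl V pl
    by (rule right_pre_lie_algebra_operad_sum)
  show ?thesis
    by unfold_locales
      (rule degree_part_subspace degree_part_subset degree_decomposition pl_degree; assumption)+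
qed

end

theorem corollary38:
  fixes scale :: "'k::field_char_0 \<Rightarrow> 'v::ab_group_add \<Rightarrow> 'v"
    and P :: "nat \<Rightarrow> 'v set"
    and \<gamma> :: "nat list \<Rightarrow> 'v \<Rightarrow> 'v list \<Rightarrow> 'v"
    and I :: 'v
  assumes "nonsigma_operad scale P \<gamma> I"
    and "P 0 = {0}"
  shows "graded_right_pre_lie_algebra (scale_sum scale) (operad_sum P) (pre_lie_prod \<gamma> I) (degree_part P)
    \<and> defines_map_on_symmetric_algebra (scale_sum scale) (operad_sum P) (brace (pre_lie_prod \<gamma> I))
    \<and> (\<forall>n. \<forall>p \<in> P n. \<forall>ps \<in> lists (operad_sum P).
        brace (pre_lie_prod \<gamma> I) (Poly_Mapping.single n p) ps =
          (\<Sum>is | length is = length ps \<and> set is \<subseteq> {1..n} \<and> distinct is.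
            insert_comp \<gamma> I n p is ps))"
proof -
  interpret reduced_nonsigma_operad scale P \<gamma> I
    using assms by (intro reduced_nonsigma_operad.intro reduced_nonsigma_operad_axioms.intro)
  have "brace pl (Poly_Mapping.single n p) ps =
      (\<Sum>is | length is = length ps \<and> set is \<subseteq> {1..n} \<and> distinct is. insert_comp \<gamma> I n p is ps)"
    if "p \<in> P n" "ps \<in> lists V" for n p ps
    using that brace_single[of p n ps]
    by (auto simp: symmetric_brace_def placements_def insert_comp_eq)
  then show ?thesis
    using graded_right_pre_lie_algebra_operad_sum brace_defines_map by blast
qed

end
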